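(* For every name $Q$: if $\eta\,Q\,\mathrm{Solid}$, then $\mathrm{InteriorG}(Q)\equiv Q$.
   Context: Logic is classical. Names form a type $N$; a name may designate zero, one or several objects. The relation $\eta : N\to N\to \mathrm{Prop}$ (singular inclusion) is governed by Leśniewski's Ontology: $\eta\,A\,b$ holds iff [there is $C$ with $\eta\,C\,A$] and [for all $C,D$, $\eta\,C\,A$ and $\eta\,D\,A$ imply $\eta\,C\,D$] and [for all $C$, $\eta\,C\,A$ implies $\eta\,C\,b$]; i.e. $A$ designates exactly one object, which is among those designated by $b$. $A$ is an Individual iff $\eta\,A\,A$. Notation: $P\equiv Q$ iff $\eta\,P\,Q$ and $\eta\,Q\,P$; $a\approx b$ iff $\forall P,\ \eta\,P\,a\leftrightarrow\eta\,P\,b$; $a\subseteq b$ iff $\forall P,\ \eta\,P\,a\to\eta\,P\,b$. Names with the same extension are interchangeable. Name-forming operators are introduced by stating when $\eta\,P\,(\cdot)$ holds. Mereology: $\eta\,P\,(\mathrm{pt}(Q))$ ("$P$ is a part of $Q$") relates individuals and is reflexive on individuals, transitive, and antisymmetric up to $\equiv$; $\eta\,P\,(\mathrm{ppt}(Q))$ (proper part) means $\eta\,P\,(\mathrm{pt}(Q))$ and not $P\equiv Q$; $\eta\,P\,(\mathrm{ext}(Q))$ means $P,Q$ are individuals with no common part. $\eta\,A\,(\mathrm{klass}(a))$ iff $A$ is an Individual, every $B$ with $\eta\,B\,a$ satisfies $\eta\,B\,(\mathrm{pt}(A))$, and for every $B$ with $\eta\,B\,(\mathrm{pt}(A))$ there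 exist $C,D$ with $\eta\,C\,a$, $\eta\,D\,(\mathrm{pt}(C))$, $\eta\,D\,(\mathrm{pt}(B))$. If some $C$ satisfies $\eta\,C\,a$, then there is $A$ with $\eta\,A\,(\mathrm{klass}(a))$, unique up to $\equiv$. Geometry: $\mathrm{balls}$ is a primitive name whose members are individuals (balls); at least one ball exists. $\eta\,P\,(\mathrm{Concent}(Q))$ means that the balls $P,Q$ are concentric in Tarski's sense: $P\equiv Q$; or $P$ is a proper part of $Q$ and any two balls $X,Y$ externally diametrical to $P$ and internally tangent to $Q$ are internally diametrical to $Q$; or the same with $P,Q$ exchanged. Here (all variables balls): $A$ is externally tangent to $B$ if $A$ is external to $B$ and of any two balls $X,Y$ having $A$ as part and external to $B$ one is part of the other; $A$ is internally tangent to $B$ if $A$ is a proper part of $B$ and of any two balls $X,Y$ having $A$ as part and being parts of $B$ one is part of the other; $A,B$ are externally diametrical to $C$ if both are externally tangent to $C$ and whenever $X,Y$ are external to $C$, $A$ is part of $X$ and $B$ is part of $Y$, then $X$ is external to $Y$; $A,B$ are internally diametrical to $C$ if both are internally tangent to $C$ and whenever $X,Y$ are external to $C$, $A$ is externally tangent to $X$ and $B$ to $Y$, then $X$ is external to $Y$. $\eta\,P\,(\mathrm{Point}(Q))$ iff $\eta\,P\,\mathrm{balls}$, $\eta\,Q\,\mathrm{balls}$ and $\eta\,P\,(\mathrm{Concent}(Q))$. Standing assumptions: concentricity is an equivalence relation on balls, and concentric balls $P,Q$ satisfy $\mathrm{Point}(P)\approx\mathrm{Point}(Q)$. $\eta\,P\,\mathrm{Solid}$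 iff $P$ is an Individual and there is $b\subseteq\mathrm{balls}$ with $\eta\,P\,(\mathrm{klass}(b))$; parts of solids are assumed to be solids. $\eta\,P\,(\mathrm{sat\_InteriorPoint}(Q))$ iff $\eta\,Q\,\mathrm{Solid}$ and there is $P'$ with $\eta\,P\,(\mathrm{Point}(P'))$, $\eta\,P'\,(\mathrm{pt}(Q))$, and ($\eta\,P'\,(\mathrm{pt}(P))\to P\equiv P'$). $\eta\,P\,(\mathrm{InteriorG}(Q))$ iff $\eta\,P\,(\mathrm{klass}(\mathrm{sat\_InteriorPoint}(Q)))$. *)

theory Defs imports Main begin

text \<open>
  Names are the elements of a type \<open>'n\<close>, and \<open>eta A b\<close> is singular inclusion.
  Name-forming operators are not obtained by a comprehension principle: each of them is a
  parameter, characterised by an assumption saying when \<open>eta P\<close> holds of its values.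
\<close>

locale names =
  fixes eta :: "'n \<Rightarrow> 'n \<Rightarrow> bool"
begin

definition individual :: "'n \<Rightarrow> bool" where
  "individual A \<longleftrightarrow> eta A A"

definition identical :: "'n \<Rightarrow> 'n \<Rightarrow> bool" where
  "identical P Q \<longleftrightarrow> eta P Q \<and> eta Q P"

definition same_extension :: "'n \<Rightarrow> 'n \<Rightarrow> bool" where
  "same_extension a b \<longleftrightarrow> (\<forall>P. eta P a \<longleftrightarrow> eta P b)"

definition subname :: "'n \<Rightarrow> 'n \<Rightarrow> bool" where
  "subname a b \<longleftrightarrow> (\<forall>P. eta P a \<longrightarrow> eta P b)"

end

locale ontology = names eta
  for eta :: "'n \<Rightarrow> 'n \<Rightarrow> bool" +
  assumes ontology_axiom:
    "eta A b \<longleftrightarrow>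
       (\<exists>C. eta C A) \<and>
       (\<forall>C D. eta C A \<and> eta D A \<longrightarrow> eta C D) \<and>
       (\<forall>C. eta C A \<longrightarrow> eta C b)"
    \<comment> \<open>Interchangeability in every context is, in higher-order logic, equality.\<close>
    and extensionality: "same_extension a b \<Longrightarrow> a = b"

locale mereology = ontology eta
  for eta :: "'n \<Rightarrow> 'n \<Rightarrow> bool" +
  fixes pt ppt ext klass :: "'n \<Rightarrow> 'n"
  assumes pt_individuals: "eta P (pt Q) \<Longrightarrow> individual P \<and> individual Q"
    and pt_refl: "individual P \<Longrightarrow> eta P (pt P)"
    and pt_trans: "eta P (pt Q) \<Longrightarrow> eta Q (pt R) \<Longrightarrow> eta P (pt R)"
    and pt_antisym: "eta P (pt Q) \<Longrightarrow> eta Q (pt P) \<Longrightarrow> identical P Q"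
    and ppt_iff: "eta P (ppt Q) \<longleftrightarrow> eta P (pt Q) \<and> \<not> identical P Q"
    and ext_iff:
      "eta P (ext Q) \<longleftrightarrow>
         individual P \<and> individual Q \<and> \<not> (\<exists>R. eta R (pt P) \<and> eta R (pt Q))"
    and klass_iff:
      "eta A (klass a) \<longleftrightarrow>
         individual A \<and>
         (\<forall>B. eta B a \<longrightarrow> eta B (pt A)) \<and>
         (\<forall>B. eta B (pt A) \<longrightarrow> (\<exists>C D. eta C a \<and> eta D (pt C) \<and> eta D (pt B)))"
    and klass_exists: "eta C a \<Longrightarrow> \<exists>A. eta A (klass a)"
    and klass_unique:
      "eta C a \<Longrightarrow> eta A (klass a) \<Longrightarrow> eta B (klass a) \<Longrightarrow> identical A B"

locale ball_relations = names eta
  for eta :: "'n \<Rightarrow> 'n \<Rightarrow> bool" +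
  fixes pt ppt ext :: "'n \<Rightarrow> 'n"
    and balls :: "'n"
begin

definition ext_tangent :: "'n \<Rightarrow> 'n \<Rightarrow> bool" where
  "ext_tangent A B \<longleftrightarrow>
     eta A balls \<and> eta B balls \<and> eta A (ext B) \<and>
     (\<forall>X Y. eta X balls \<and> eta Y balls \<and>
        eta A (pt X) \<and> eta X (ext B) \<and> eta A (pt Y) \<and> eta Y (ext B)
        \<longrightarrow> eta X (pt Y) \<or> eta Y (pt X))"

definition int_tangent :: "'n \<Rightarrow> 'n \<Rightarrow> bool" where
  "int_tangent A B \<longleftrightarrow>
     eta A balls \<and> eta B balls \<and> eta A (ppt B) \<and>
     (\<forall>X Y. eta X balls \<and> eta Y balls \<and>
        eta A (pt X) \<and> eta X (pt B) \<and> eta A (pt Y) \<and> eta Y (pt B)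
        \<longrightarrow> eta X (pt Y) \<or> eta Y (pt X))"

definition ext_diametrical :: "'n \<Rightarrow> 'n \<Rightarrow> 'n \<Rightarrow> bool" where
  "ext_diametrical A B C \<longleftrightarrow>
     ext_tangent A C \<and> ext_tangent B C \<and>
     (\<forall>X Y. eta X balls \<and> eta Y balls \<and>
        eta X (ext C) \<and> eta Y (ext C) \<and> eta A (pt X) \<and> eta B (pt Y)
        \<longrightarrow> eta X (ext Y))"

definition int_diametrical :: "'n \<Rightarrow> 'n \<Rightarrow> 'n \<Rightarrow> bool" where
  "int_diametrical A B C \<longleftrightarrow>
     int_tangent A C \<and> int_tangent B C \<and>
     (\<forall>X Y. eta X balls \<and> eta Y balls \<and>
        eta X (ext C) \<and> eta Y (ext C) \<and> ext_tangent A X \<and> ext_tangent B Y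
        \<longrightarrow> eta X (ext Y))"

definition inner_concentric :: "'n \<Rightarrow> 'n \<Rightarrow> bool" where
  "inner_concentric P Q \<longleftrightarrow>
     eta P (ppt Q) \<and>
     (\<forall>X Y. eta X balls \<and> eta Y balls \<and>
        ext_diametrical X Y P \<and> int_tangent X Q \<and> int_tangent Y Q
        \<longrightarrow> int_diametrical X Y Q)"

definition concentric :: "'n \<Rightarrow> 'n \<Rightarrow> bool" where
  "concentric P Q \<longleftrightarrow>
     eta P balls \<and> eta Q balls \<and>
     (identical P Q \<or> inner_concentric P Q \<or> inner_concentric Q P)"

end

locale solid_geometry =
  mereology eta pt ppt ext klass + ball_relations eta pt ppt ext balls
  for eta :: "'n \<Rightarrow> 'n \<Rightarrow> bool"
    and pt ppt ext klass :: "'n \<Rightarrow> 'n"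
    and balls :: "'n" +
  fixes Concent Point :: "'n \<Rightarrow> 'n"
    and Solid :: "'n"
    and sat_InteriorPoint InteriorG :: "'n \<Rightarrow> 'n"
  assumes balls_individuals: "eta B balls \<Longrightarrow> individual B"
    and ball_exists: "\<exists>B. eta B balls"
    and Concent_iff: "eta P (Concent Q) \<longleftrightarrow> concentric P Q"
    and Point_iff: "eta P (Point Q) \<longleftrightarrow> eta P balls \<and> eta Q balls \<and> eta P (Concent Q)"
    and Concent_equiv: "equiv {P. eta P balls} {(P, Q). eta P (Concent Q)}"
    and Point_concentric: "eta P (Concent Q) \<Longrightarrow> same_extension (Point P) (Point Q)"
    and Solid_iff:
      "eta P Solid \<longleftrightarrow> individual P \<and> (\<exists>b. subname b balls \<and> eta P (klass b))"
    and Solid_part: "eta Q Solid \<Longrightarrow> eta P (pt Q) \<Longrightarrow> eta P Solid"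
    and sat_InteriorPoint_iff:
      "eta P (sat_InteriorPoint Q) \<longleftrightarrow>
         eta Q Solid \<and>
         (\<exists>P'. eta P (Point P') \<and> eta P' (pt Q) \<and> (eta P' (pt P) \<longrightarrow> identical P P'))"
    and InteriorG_iff: "eta P (InteriorG Q) \<longleftrightarrow> eta P (klass (sat_InteriorPoint Q))"

end

theory Submission imports Defs begin

text \<open>
  The condition \<open>eta P' (pt P) \<longrightarrow> identical P P'\<close> in \<open>sat_InteriorPoint\<close> keeps \<open>P\<close> from being a
  strictly larger ball about the centre of \<open>P'\<close>. Since concentric balls are comparable, \<open>P\<close> is then
  itself a part of \<open>P'\<close>, hence of \<open>Q\<close>; conversely a ball that is a part of \<open>Q\<close> is its own witness
  \<open>P'\<close>. So the name \<open>sat_InteriorPoint Q\<close> designates exactly the balls that are parts of the solid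
  \<open>Q\<close> (lemma \<open>sat_InteriorPoint_iff_ball_part\<close>).

  A solid is the class of the balls among its parts: each part \<open>B\<close> of \<open>Q\<close> is again a solid, hence a
  class of balls, and so contains a ball (lemma \<open>solid_contains_ball\<close>), which is then a part of
  both \<open>B\<close> and \<open>Q\<close>. Thus \<open>Q\<close> is a class of \<open>sat_InteriorPoint Q\<close>, and uniqueness of classes turns
  this into an identity.
\<close>

text \<open>
  By the ontology axiom, \<open>eta P Q\<close> implies that all that \<open>P\<close> designates is designated by \<open>Q\<close>, so
  identical individuals are coextensive and extensionality applies.
\<close>

lemma (in ontology) identical_imp_eq: "identical P Q \<Longrightarrow> P = Q"
  using ontology_axiom [of P Q] ontology_axiom [of Q P] extensionality [of P Q]
  unfolding identical_def same_extension_def by blast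

context solid_geometry
begin

lemma concentric_comparable:
  "concentric P Q \<Longrightarrow> eta P (pt Q) \<or> eta Q (pt P)"
  using pt_refl balls_individuals identical_imp_eq
  unfolding concentric_def inner_concentric_def ppt_iff by blast

lemma Point_refl: "eta P balls \<Longrightarrow> eta P (Point P)"
  using Concent_equiv unfolding Point_iff equiv_def refl_on_def by blast

lemma sat_InteriorPoint_iff_ball_part:
  assumes "eta Q Solid"
  shows "eta P (sat_InteriorPoint Q) \<longleftrightarrow> eta P balls \<and> eta P (pt Q)"
proof
  assume "eta P (sat_InteriorPoint Q)"
  then obtain P' where P': "eta P (Point P')" "eta P' (pt Q)"
      and not_larger: "eta P' (pt P) \<longrightarrow> identical P P'"
    unfolding sat_InteriorPoint_iff by blast
  have "eta P balls" and "concentric P P'"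
    using P' by (simp_all add: Point_iff Concent_iff)
  moreover have "eta P (pt Q)"
    using concentric_comparable [OF \<open>concentric P P'\<close>]
  proof
    assume "eta P (pt P')"
    then show ?thesis using P'(2) by (rule pt_trans)
  next
    assume "eta P' (pt P)"
    then show ?thesis using not_larger identical_imp_eq P'(2) by blast
  qed
  ultimately show "eta P balls \<and> eta P (pt Q)" by blast
next
  assume P: "eta P balls \<and> eta P (pt Q)"
  then have "identical P P"
    using balls_individuals by (simp add: identical_def individual_def)
  then show "eta P (sat_InteriorPoint Q)"
    using assms P Point_refl unfolding sat_InteriorPoint_iff by blast
qed

text \<open>
  A class has the individuals it is formed from as parts, and one of them exists because the class,
  being a part of itself, must overlap one of them.
\<close>

lemma solid_contains_ball:
  assumes "eta B Solid"
  obtains C where "eta C balls" and "eta C (pt B)"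
proof -
  from assms obtain b where "subname b balls" and B: "individual B" "eta B (klass b)"
    unfolding Solid_iff by blast
  have "eta B (pt B)" using B(1) by (rule pt_refl)
  then obtain C where "eta C b" and "eta C (pt B)"
    using B(2) unfolding klass_iff by blast
  then show thesis
    using \<open>subname b balls\<close> that unfolding subname_def by blast
qed

lemma solid_is_InteriorG:
  assumes "eta Q Solid"
  shows "eta Q (InteriorG Q)"
  unfolding InteriorG_iff klass_iff sat_InteriorPoint_iff_ball_part [OF assms]
proof (intro conjI allI impI)
  show "individual Q" using assms by (simp add: Solid_iff)
next
  fix B assume "eta B balls \<and> eta B (pt Q)"
  then show "eta B (pt Q)" by blast
next
  fix B assume "eta B (pt Q)"
  with assms have "eta B Solid" by (rule Solid_part)
  then obtain C where C: "eta C balls" "eta C (pt B)"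
    by (rule solid_contains_ball)
  have "eta C (pt C)" and "eta C (pt Q)"
    using C \<open>eta B (pt Q)\<close> pt_refl balls_individuals pt_trans by blast+
  then show "\<exists>C D. (eta C balls \<and> eta C (pt Q)) \<and> eta D (pt C) \<and> eta D (pt B)"
    using C by blast
qed

text \<open>
  Uniqueness of classes is postulated only for names that designate something; for
  \<open>sat_InteriorPoint Q\<close> this holds because a solid contains a ball.
\<close>

lemma InteriorG_unique:
  assumes "eta Q Solid" and "eta A (InteriorG Q)"
  shows "A = Q"
proof -
  obtain C where "eta C (sat_InteriorPoint Q)"
    using solid_contains_ball [OF assms(1)] sat_InteriorPoint_iff_ball_part [OF assms(1)] by blast
  then have "identical A Q"
    using klass_unique assms(2) solid_is_InteriorG [OF assms(1)]
    unfolding InteriorG_iff by blast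
  then show ?thesis by (rule identical_imp_eq)
qed

lemma InteriorG_identical:
  assumes "eta Q Solid"
  shows "identical (InteriorG Q) Q"
proof -
  have "eta Q Q" using assms by (simp add: Solid_iff individual_def)
  moreover have "eta Q (InteriorG Q)" using assms by (rule solid_is_InteriorG)
  (* The converse inclusion says in addition that the name InteriorG Q is singular. *)
  moreover have "eta (InteriorG Q) Q"
    unfolding ontology_axiom [of "InteriorG Q" Q]
    using calculation InteriorG_unique [OF assms] by blast
  ultimately show ?thesis by (simp add: identical_def)
qed

end

theorem theorem13:
  fixes eta :: "'n \<Rightarrow> 'n \<Rightarrow> bool"
    and pt ppt ext klass :: "'n \<Rightarrow> 'n"
    and balls :: "'n"
    and Concent Point :: "'n \<Rightarrow> 'n"
    and Solid :: "'n"
    and sat_InteriorPoint InteriorG :: "'n \<Rightarrow> 'n"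
    and Q :: "'n"
  assumes "solid_geometry eta pt ppt ext klass balls Concent Point Solid sat_InteriorPoint InteriorG"
    and "eta Q Solid"
  shows "names.identical eta (InteriorG Q) Q"
  using assms by (rule solid_geometry.InteriorG_identical)

end
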